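(* Problem (SL1) stated in the context can be rewritten in the variable $x:=(z_1,\dots,z_m,x_{m+1})\in\mathbb{R}^{m+1}$ as $$\text{(SL1.2)}\qquad \min_{x\in\mathbb{R}^{m+1}}\ \|x\|^2\quad\text{s.t.}\quad f_\Omega(x)\le 0,\quad (\mathbf{1},0)^\top x=p,\quad g(x)\le 0,\quad 0\le x_i\le 1,\ i=1,\dots,m,$$ where $\Omega$ is the optimal value of the auxiliary convex problem $$\min_{z\in\mathbb{R}^m}\ -\log\det\Bigl(\sum_{i=1}^m z_iA_i+\delta I\Bigr)\quad\text{s.t.}\quad \mathbf{1}^\top z=p,\ \ 0\le z_i\le 1,\ i=1,\dots,m,$$ $\eta:=\Omega-p^2$, $$f_\Omega(x):=-\log\det\Bigl(\sum_{i=1}^m z_iA_i+\delta I\Bigr)-\eta-\|x\|^2,$$ and $$g(x)=g(z):=\sum_{i=1}^m\Bigl|\bigl(z_i-\tfrac12\bigr)^2-\tfrac14\Bigr|.$$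
   Context: Let $a_1,\dots,a_m\in\mathbb{R}^n$, $A_i=a_ia_i^\top$, $\delta>0$, and let $I$ be the $n\times n$ identity matrix. $\|\cdot\|$ is the Euclidean norm and $\mathbf{1}=(1,\dots,1)^\top\in\mathbb{R}^m$, so that $(\mathbf{1},0)^\top x=\sum_{i=1}^m z_i$. Problem (SL1) is the sensor selection problem $$\text{(SL1)}\qquad \max_{z}\ \log\det\Bigl(\sum_{i=1}^m z_ia_ia_i^\top+\delta I\Bigr)\quad\text{s.t.}\quad \mathbf{1}^\top z=p,\ \ z_i\in\{0,1\},\ i=1,\dots,m,$$ where $m$ is the number of candidate sensor locations and $p$ the number of sensors to select ($p\ge n$ when the problem is introduced). Standing setting of the result: the vectors $a_1,\dots,a_m$ are assumed to be linearly independent, and exactly $p=n$ of the variables $z_i$ are selected to be equal to one. *)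

theory Defs
  imports "HOL-Analysis.Analysis"
begin

text \<open>
  The family \<open>a\<close> of \<open>m\<close> vectors in \<open>R^n\<close> is a function from a finite index type \<open>'m\<close> to
  \<^typ>\<open>real^'n\<close>.  A point \<open>x = (z, x_{m+1})\<close> of \<open>R^{m+1}\<close> is a pair of type
  \<^typ>\<open>(real^'m) \<times> real\<close>, whose library norm and inner product are the Euclidean ones.
\<close>

definition outer_product :: "real^'n \<Rightarrow> real^'n^'n"
  where "outer_product v = (\<chi> i j. v $ i * v $ j)"

definition sensor_matrix :: "('m::finite \<Rightarrow> real^'n) \<Rightarrow> real \<Rightarrow> real^'m \<Rightarrow> real^'n^'n"
  where "sensor_matrix a \<delta> z = (\<Sum>i\<in>UNIV. z $ i *\<^sub>R outer_product (a i)) + \<delta> *\<^sub>R mat 1"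

text \<open>
  For \<open>\<delta> > 0\<close> and \<open>z \<ge> 0\<close>, as everywhere on the feasible sets below, the matrix is positive
  definite, so the logarithm is applied to a positive number.
\<close>

definition logdet :: "('m::finite \<Rightarrow> real^'n) \<Rightarrow> real \<Rightarrow> real^'m \<Rightarrow> real"
  where "logdet a \<delta> z = ln (det (sensor_matrix a \<delta> z))"

definition feasible_SL1 :: "nat \<Rightarrow> (real^'m::finite) set"
  where "feasible_SL1 p = {z. 1 \<bullet> z = real p \<and> (\<forall>i. z $ i \<in> {0, 1})}"

definition feasible_relaxed :: "nat \<Rightarrow> (real^'m::finite) set"
  where "feasible_relaxed p = {z. 1 \<bullet> z = real p \<and> (\<forall>i. 0 \<le> z $ i \<and> z $ i \<le> 1)}"

text \<open>
  The relaxed feasible set is compact and the objective is continuous on it, so this infimum of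
  reals is an attained minimum unless the set is empty (\<open>p > m\<close>).  In that case the value is
  unspecified, but then no problem considered here has a feasible point.
\<close>

definition Omega :: "('m::finite \<Rightarrow> real^'n) \<Rightarrow> real \<Rightarrow> nat \<Rightarrow> real"
  where "Omega a \<delta> p = (INF z\<in>feasible_relaxed p. - logdet a \<delta> z)"

definition eta :: "('m::finite \<Rightarrow> real^'n) \<Rightarrow> real \<Rightarrow> nat \<Rightarrow> real"
  where "eta a \<delta> p = Omega a \<delta> p - (real p)\<^sup>2"

definition f_Omega :: "('m::finite \<Rightarrow> real^'n) \<Rightarrow> real \<Rightarrow> nat \<Rightarrow> (real^'m) \<times> real \<Rightarrow> real"
  where "f_Omega a \<delta> p x = - logdet a \<delta> (fst x) - eta a \<delta> p - (norm x)\<^sup>2"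

definition g :: "(real^'m::finite) \<times> real \<Rightarrow> real"
  where "g x = (\<Sum>i\<in>UNIV. \<bar>(fst x $ i - 1/2)\<^sup>2 - 1/4\<bar>)"

definition feasible_SL12 ::
    "('m::finite \<Rightarrow> real^'n) \<Rightarrow> real \<Rightarrow> nat \<Rightarrow> ((real^'m) \<times> real) set"
  where "feasible_SL12 a \<delta> p =
    {x. f_Omega a \<delta> p x \<le> 0 \<and> (1, 0) \<bullet> x = real p \<and> g x \<le> 0 \<and>
        (\<forall>i. 0 \<le> fst x $ i \<and> fst x $ i \<le> 1)}"

definition optimal_SL1 :: "('m::finite \<Rightarrow> real^'n) \<Rightarrow> real \<Rightarrow> nat \<Rightarrow> real^'m \<Rightarrow> bool"
  where "optimal_SL1 a \<delta> p = is_arg_max (logdet a \<delta>) (\<lambda>z. z \<in> feasible_SL1 p)"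

definition optimal_SL12 ::
    "('m::finite \<Rightarrow> real^'n) \<Rightarrow> real \<Rightarrow> nat \<Rightarrow> (real^'m) \<times> real \<Rightarrow> bool"
  where "optimal_SL12 a \<delta> p = is_arg_min (\<lambda>x. (norm x)\<^sup>2) (\<lambda>x. x \<in> feasible_SL12 a \<delta> p)"

text \<open>Extended reals, so that an infeasible maximisation (minimisation) has value
  \<open>-\<infinity>\<close> (\<open>\<infinity>\<close>).\<close>

definition value_SL1 :: "('m::finite \<Rightarrow> real^'n) \<Rightarrow> real \<Rightarrow> nat \<Rightarrow> ereal"
  where "value_SL1 a \<delta> p = (SUP z\<in>feasible_SL1 p. ereal (logdet a \<delta> z))"

definition value_SL12 :: "('m::finite \<Rightarrow> real^'n) \<Rightarrow> real \<Rightarrow> nat \<Rightarrow> ereal"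
  where "value_SL12 a \<delta> p = (INF x\<in>feasible_SL12 a \<delta> p. ereal ((norm x)\<^sup>2))"

end

theory Submission
  imports Defs
begin

text \<open>
  The constraint \<open>g x \<le> 0\<close> forces \<open>z\<close> to be binary, so \<open>\<parallel>z\<parallel>\<^sup>2 = 1\<^sup>T z = p\<close> on the feasible set.  The
  constraint \<open>f_Omega x \<le> 0\<close> reads \<open>\<parallel>x\<parallel>\<^sup>2 \<ge> - logdet z - \<eta>\<close>; its right-hand side is at least
  \<open>p\<^sup>2 \<ge> p = \<parallel>z\<parallel>\<^sup>2\<close> because \<open>\<Omega>\<close> is a lower bound of \<open>- logdet\<close>, so it can be attained with equality by
  choosing the free coordinate \<open>x_{m+1}\<close>.  Minimising \<open>\<parallel>x\<parallel>\<^sup>2\<close> is thus maximising \<open>logdet\<close>.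
\<close>

lemma ln_le_abs: "ln x \<le> \<bar>x\<bar>" for x :: real
  using ln_bound[of "\<bar>x\<bar>"] ln_minus[of x] by (cases "x = 0") (auto simp: abs_if split: if_splits)

lemma continuous_on_det [continuous_intros]:
  fixes f :: "'a::topological_space \<Rightarrow> real^'n^'n"
  assumes "continuous_on S f"
  shows "continuous_on S (\<lambda>x. det (f x))"
  unfolding det_def by (intro continuous_intros assms)

lemma continuous_on_sensor_matrix: "continuous_on S (sensor_matrix a \<delta>)"
  unfolding sensor_matrix_def by (intro continuous_intros)

text \<open>
  Since the library's \<open>ln\<close> satisfies \<open>ln x \<le> \<bar>x\<bar>\<close> also for \<open>x \<le> 0\<close>, where its value is junk, a bound
  on the determinant suffices and its positivity plays no role.
\<close>

lemma bdd_below_relaxed: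
  fixes a :: "'m::finite \<Rightarrow> real^'n"
  shows "bdd_below ((\<lambda>z. - logdet a \<delta> z) ` feasible_relaxed p)"
proof -
  \<comment> \<open>The unit cube contains \<open>feasible_relaxed p\<close> and is compact
    outright, so the bound is taken there.\<close>
  have "compact ((\<lambda>z. det (sensor_matrix a \<delta> z)) ` cbox 0 1)"
    by (intro compact_continuous_image continuous_intros continuous_on_sensor_matrix) simp
  then obtain B where B: "\<And>z. z \<in> cbox 0 1 \<Longrightarrow> \<bar>det (sensor_matrix a \<delta> z)\<bar> \<le> B"
    by (force dest!: compact_imp_bounded simp: bounded_iff)
  show ?thesis
  proof (rule bdd_belowI2)
    fix z :: "real^'m" assume "z \<in> feasible_relaxed p"
    then have "z \<in> cbox 0 1"
      by (simp add: feasible_relaxed_def mem_box_cart)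
    from B[OF this] show "- B \<le> - logdet a \<delta> z"
      using ln_le_abs[of "det (sensor_matrix a \<delta> z)"] by (simp add: logdet_def)
  qed
qed

text \<open>An infimum of reals is a lower bound only for a set bounded below, hence
  \<open>bdd_below_relaxed\<close>.\<close>

lemma Omega_le: "z \<in> feasible_relaxed p \<Longrightarrow> Omega a \<delta> p \<le> - logdet a \<delta> z"
  unfolding Omega_def by (rule cINF_lower[OF bdd_below_relaxed])

lemma feasible_SL1_subset_relaxed: "feasible_SL1 p \<subseteq> feasible_relaxed p"
proof
  fix z :: "real^'a" assume z: "z \<in> feasible_SL1 p"
  have "0 \<le> z $ i \<and> z $ i \<le> 1" for i
    using z by (auto simp: feasible_SL1_def dest: spec[of _ i])
  with z show "z \<in> feasible_relaxed p"
    by (simp add: feasible_SL1_def feasible_relaxed_def)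
qed

text \<open>Each summand of \<open>g\<close> is the absolute value of
  \<open>z $ i * (z $ i - 1)\<close>, so the sum is nonpositive only if every product
  vanishes.\<close>

lemma g_nonpos_iff: "g (z, t) \<le> 0 \<longleftrightarrow> (\<forall>i. z $ i \<in> {0, 1})"
proof -
  have "g (z, t) \<le> 0 \<longleftrightarrow> g (z, t) = 0"
    unfolding g_def by (intro antisym_conv sum_nonneg) simp
  also have "\<dots> \<longleftrightarrow> (\<forall>i. (z $ i - 1/2)\<^sup>2 - 1/4 = 0)"
    by (simp add: g_def sum_nonneg_eq_0_iff)
  also have "\<dots> \<longleftrightarrow> (\<forall>i. z $ i * (z $ i - 1) = 0)"
    by (intro all_cong1 arg_cong[of _ _ "\<lambda>u. u = 0"]) (simp add: power2_eq_square field_simps)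
  finally show ?thesis
    by auto
qed

lemma norm_square_SL1:
  assumes "z \<in> feasible_SL1 p"
  shows "(norm z)\<^sup>2 = real p"
proof -
  have "z $ i * z $ i = z $ i" for i
    using assms by (auto simp: feasible_SL1_def dest: spec[of _ i])
  then have "(norm z)\<^sup>2 = 1 \<bullet> z"
    unfolding power2_norm_eq_inner inner_vec_def by (intro sum.cong) auto
  with assms show ?thesis
    by (simp add: feasible_SL1_def)
qed

lemma norm_Pair_square: "(norm (z, t))\<^sup>2 = (norm z)\<^sup>2 + t\<^sup>2" for t :: real
  by (simp add: norm_Pair)

text \<open>Over a fixed binary \<open>z\<close> only \<open>f_Omega\<close> involves
  \<open>t\<close>, and it becomes a lower bound on the norm that depends on \<open>z\<close>
  alone.\<close>

lemma feasible_SL12_iff: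
  "(z, t) \<in> feasible_SL12 a \<delta> p \<longleftrightarrow>
    z \<in> feasible_SL1 p \<and> - logdet a \<delta> z - eta a \<delta> p \<le> (norm (z, t))\<^sup>2"
  using feasible_SL1_subset_relaxed[of p]
  by (auto simp: feasible_SL12_def f_Omega_def g_nonpos_iff feasible_SL1_def feasible_relaxed_def)

lemma ex_norm_square_eq:
  assumes z: "z \<in> feasible_SL1 p"
  obtains t :: real where "(norm (z, t))\<^sup>2 = - logdet a \<delta> z - eta a \<delta> p"
proof -
  \<comment> \<open>This holds because \<open>p\<close> is a natural number; it is why
    \<open>eta\<close> shifts \<open>Omega\<close> by the square of \<open>p\<close>.\<close>
  have "p \<le> p\<^sup>2"
    by (simp add: power2_eq_square)
  then have "real p \<le> (real p)\<^sup>2"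
    by (metis of_nat_le_iff of_nat_power)
  moreover have "Omega a \<delta> p \<le> - logdet a \<delta> z"
    using z feasible_SL1_subset_relaxed by (blast intro: Omega_le)
  ultimately have "0 \<le> - logdet a \<delta> z - eta a \<delta> p - real p"
    unfolding eta_def by linarith
  \<comment> \<open>The last coordinate makes up exactly what the norm of \<open>z\<close>, whose
    square is \<open>p\<close>, leaves missing.\<close>
  then have "(norm (z, sqrt (- logdet a \<delta> z - eta a \<delta> p - real p)))\<^sup>2 = - logdet a \<delta> z - eta a \<delta> p"
    unfolding norm_Pair_square norm_square_SL1[OF z] by simp
  then show ?thesis
    by (rule that)
qed

lemma fst_feasible_SL12:
  fixes a :: "'m::finite \<Rightarrow> real^'n"
  shows "fst ` feasible_SL12 a \<delta> p = feasible_SL1 p"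
proof (intro set_eqI iffI)
  fix z :: "real^'m" assume z: "z \<in> feasible_SL1 p"
  obtain t :: real where "(norm (z, t))\<^sup>2 = - logdet a \<delta> z - eta a \<delta> p"
    using ex_norm_square_eq[OF z] .
  with z have "(z, t) \<in> feasible_SL12 a \<delta> p"
    by (simp add: feasible_SL12_iff)
  then show "z \<in> fst ` feasible_SL12 a \<delta> p"
    by force
qed (auto simp: feasible_SL12_iff)

lemma ex_minimal_lift:
  assumes z: "z \<in> feasible_SL1 p"
  shows "\<exists>t. is_arg_min (\<lambda>t. (norm (z, t))\<^sup>2) (\<lambda>t. (z, t) \<in> feasible_SL12 a \<delta> p) t
    \<and> (norm (z, t))\<^sup>2 = - logdet a \<delta> z - eta a \<delta> p"
proof -
  obtain t :: real where "(norm (z, t))\<^sup>2 = - logdet a \<delta> z - eta a \<delta> p"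
    using ex_norm_square_eq[OF z] .
  with z show ?thesis
    by (intro exI[of _ t]) (auto simp: is_arg_min_linorder feasible_SL12_iff)
qed

lemma optimal_SL1_eq_fst_optimal_SL12:
  "{z. optimal_SL1 a \<delta> p z} = fst ` {x. optimal_SL12 a \<delta> p x}"
proof (intro set_eqI iffI)
  fix z assume "z \<in> {z. optimal_SL1 a \<delta> p z}"
  then have z: "z \<in> feasible_SL1 p"
    and opt: "\<And>w. w \<in> feasible_SL1 p \<Longrightarrow> logdet a \<delta> w \<le> logdet a \<delta> z"
    by (auto simp: optimal_SL1_def is_arg_max_linorder)
  obtain t :: real where t: "(norm (z, t))\<^sup>2 = - logdet a \<delta> z - eta a \<delta> p"
    using ex_norm_square_eq[OF z] .
  \<comment> \<open>The lower bound over \<open>w\<close> is at least the one over \<open>z\<close>,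
    which \<open>(z, t)\<close> attains.\<close>
  have "(norm (z, t))\<^sup>2 \<le> (norm (w, s))\<^sup>2" if "(w, s) \<in> feasible_SL12 a \<delta> p" for w s
    using that opt[of w] t by (simp add: feasible_SL12_iff)
  with z t have "optimal_SL12 a \<delta> p (z, t)"
    by (auto simp: optimal_SL12_def is_arg_min_linorder feasible_SL12_iff)
  then show "z \<in> fst ` {x. optimal_SL12 a \<delta> p x}"
    by force
next
  fix z assume "z \<in> fst ` {x. optimal_SL12 a \<delta> p x}"
  then obtain t where zt: "(z, t) \<in> feasible_SL12 a \<delta> p"
    and opt: "\<And>x. x \<in> feasible_SL12 a \<delta> p \<Longrightarrow> (norm (z, t))\<^sup>2 \<le> (norm x)\<^sup>2"
    unfolding optimal_SL12_def is_arg_min_linorder by auto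
  \<comment> \<open>Comparing with a lift of \<open>w\<close> that attains its lower bound turns the
    inequality of norms into one of \<open>logdet\<close>.\<close>
  have "logdet a \<delta> w \<le> logdet a \<delta> z" if w: "w \<in> feasible_SL1 p" for w
  proof -
    obtain s :: real where s: "(norm (w, s))\<^sup>2 = - logdet a \<delta> w - eta a \<delta> p"
      using ex_norm_square_eq[OF w] .
    with w have "(norm (z, t))\<^sup>2 \<le> (norm (w, s))\<^sup>2"
      by (intro opt) (simp add: feasible_SL12_iff)
    with zt s show ?thesis
      by (simp add: feasible_SL12_iff)
  qed
  with zt show "z \<in> {z. optimal_SL1 a \<delta> p z}"
    by (auto simp: optimal_SL1_def is_arg_max_linorder feasible_SL12_iff)
qed

lemma value_SL12_eq: "value_SL12 a \<delta> p = - value_SL1 a \<delta> p - ereal (eta a \<delta> p)"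
proof -
  have "value_SL12 a \<delta> p = (INF z\<in>feasible_SL1 p. ereal (- logdet a \<delta> z - eta a \<delta> p))"
    unfolding value_SL12_def
  \<comment> \<open>Each family is dominated by the other: tight lifts give one direction, the lower
    bound in \<open>feasible_SL12_iff\<close> the other.\<close>
  proof (rule INF_eq)
    fix z :: "real^'a" assume z: "z \<in> feasible_SL1 p"
    obtain t :: real where t: "(norm (z, t))\<^sup>2 = - logdet a \<delta> z - eta a \<delta> p"
      using ex_norm_square_eq[OF z] .
    with z show "\<exists>x\<in>feasible_SL12 a \<delta> p. ereal ((norm x)\<^sup>2) \<le> ereal (- logdet a \<delta> z - eta a \<delta> p)"
      by (intro bexI[of _ "(z, t)"]) (auto simp: feasible_SL12_iff)
  next
    fix x :: "(real^'a) \<times> real" assume "x \<in> feasible_SL12 a \<delta> p"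
    then show "\<exists>z\<in>feasible_SL1 p. ereal (- logdet a \<delta> z - eta a \<delta> p) \<le> ereal ((norm x)\<^sup>2)"
      by (cases x) (auto simp: feasible_SL12_iff)
  qed
  also have "\<dots> = - value_SL1 a \<delta> p - ereal (eta a \<delta> p)"
  proof (cases "feasible_SL1 p = ({} :: (real^'a) set)")
    \<comment> \<open>Both sides are \<infinity> here; pulling the constant out of the infimum below
      requires a nonempty set.\<close>
    case True
    then show ?thesis
      by (simp add: value_SL1_def bot_ereal_def top_ereal_def)
  next
    case False
    have "(INF z\<in>feasible_SL1 p. ereal (- logdet a \<delta> z - eta a \<delta> p))
        = (INF z\<in>feasible_SL1 p. ereal (- eta a \<delta> p) - ereal (logdet a \<delta> z))"
      by (intro INF_cong) simp_all
    also have "\<dots> = ereal (- eta a \<delta> p) - value_SL1 a \<delta> p"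
      unfolding value_SL1_def by (rule INF_ereal_minus_right) (use False in auto)
    also have "\<dots> = - value_SL1 a \<delta> p - ereal (eta a \<delta> p)"
      by (simp add: minus_ereal_def add.commute)
    finally show ?thesis .
  qed
  finally show ?thesis .
qed

theorem proposition5p2:
  fixes a :: "'m::finite \<Rightarrow> real^'n" and \<delta> :: real and p :: nat
  assumes "\<delta> > 0"
    and "inj a" and "independent (range a)"
    and "p = CARD('n)"
  shows "fst ` feasible_SL12 a \<delta> p = feasible_SL1 p
    \<and> (\<forall>z\<in>feasible_SL1 p. \<exists>t.
          is_arg_min (\<lambda>t. (norm (z, t))\<^sup>2) (\<lambda>t. (z, t) \<in> feasible_SL12 a \<delta> p) t
        \<and> (norm (z, t))\<^sup>2 = - logdet a \<delta> z - eta a \<delta> p)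
    \<and> {z. optimal_SL1 a \<delta> p z} = fst ` {x. optimal_SL12 a \<delta> p x}
    \<and> value_SL12 a \<delta> p = - value_SL1 a \<delta> p - ereal (eta a \<delta> p)"
  by (intro conjI ballI fst_feasible_SL12 ex_minimal_lift optimal_SL1_eq_fst_optimal_SL12
      value_SL12_eq)

end
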